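(* Let $k\ge 0$ be an integer, $n=2^k$, let $\kappa_0\le\kappa_1\le\dots\le\kappa_{n-1}$ be real numbers and set $\kappa_{-1}=-\infty$, $\kappa_n=+\infty$. Let $\kappa'\le\kappa''$ be real numbers, let $r'=\min\{r\in[[-1,n]] : \kappa'\le\kappa_r\}$ and $r''=\max\{r\in[[-1,n]] : \kappa_r\le\kappa''\}$. Let $s\in[[0,n-1]]$. For $t\ge 0$ put $x_t=\mathrm{rev}_k((s+t)\bmod n)$, and define $\mathrm{lb}_t,\mathrm{ub}_t,\mathrm{used}_t,\mathrm{hit}_t$ by: $\mathrm{lb}_0=0$, $\mathrm{ub}_0=n-1$; $\mathrm{used}_t=1$ if $\mathrm{lb}_t\le x_t\le\mathrm{ub}_t$ and $\mathrm{used}_t=0$ otherwise; if $\mathrm{used}_t=1$ and $\kappa_{x_t}<\kappa'$ then $\mathrm{lb}_{t+1}=x_t+1$, $\mathrm{ub}_{t+1}=\mathrm{ub}_t$; if $\mathrm{used}_t=1$ and $\kappa''<\kappa_{x_t}$ then $\mathrm{ub}_{t+1}=x_t-1$, $\mathrm{lb}_{t+1}=\mathrm{lb}_t$; in all other cases $\mathrm{lb}_{t+1}=\mathrm{lb}_t$, $\mathrm{ub}_{t+1}=\mathrm{ub}_t$; $\mathrm{hit}_t=1$ if $r'\le x_t\le r''$ and $\mathrm{hit}_t=0$ otherwise. Let $\mathrm{en}(t)=\sum_{j=1}^{t}\mathrm{used}_j$ and $\tau=\min\{t\ge 0 : \mathrm{hit}_t=1 \text{ or } \mathrm{lb}_{t+1}>\mathrm{ub}_{t+1}\}$.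 Then $\tau<n$ and $\mathrm{en}(\tau)\le 2k+1$.
   Context: For integers $a,b$, $[[a,b]]=\{x\in\mathbb{Z}: a\le x\le b\}$. For $x\in[[0,2^k-1]]$ with binary representation $x=\sum_{i=0}^{k-1}x_i2^i$ ($x_i\in\{0,1\}$), the $k$-bit reversal is $\mathrm{rev}_k(x)=\sum_{i=0}^{k-1}x_i2^{k-1-i}$. Interpretation: a broadcaster transmits in time slot $u$ the key $\kappa_{\mathrm{rev}_k(u\bmod n)}$; a receiver searching for keys in $[\kappa',\kappa'']$ starts at slot $s$ and at receiver time $t$ listens (used$_t=1$) exactly when the transmitted index lies in its current interval $[\mathrm{lb}_t,\mathrm{ub}_t]$. *)

theory Defs
  imports Complex_Main "HOL-Library.Extended_Real"
begin

definition bit_rev :: "nat \<Rightarrow> nat \<Rightarrow> nat" where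
  "bit_rev k x = (\<Sum>i<k. of_bool (bit x i) * 2 ^ (k - 1 - i))"

definition slot_index :: "nat \<Rightarrow> nat \<Rightarrow> nat \<Rightarrow> nat" where
  "slot_index k s t = bit_rev k ((s + t) mod 2 ^ k)"

text \<open>The keys are given on the indices \<open>0, \<dots>, n - 1\<close>; the sentinels at
  \<open>-1\<close> and \<open>n\<close> are \<open>-\<infinity>\<close> and \<open>\<infinity>\<close>. Only indices in \<open>{-1..n}\<close> are meaningful.\<close>

definition ext_key :: "nat \<Rightarrow> (nat \<Rightarrow> real) \<Rightarrow> int \<Rightarrow> ereal" where
  "ext_key n \<kappa> r = (if r < 0 then -\<infinity> else if r \<ge> int n then \<infinity> else ereal (\<kappa> (nat r)))"

definition min_rank :: "nat \<Rightarrow> (nat \<Rightarrow> real) \<Rightarrow> real \<Rightarrow> int" where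
  "min_rank n \<kappa> a = Min {r \<in> {-1..int n}. ereal a \<le> ext_key n \<kappa> r}"

definition max_rank :: "nat \<Rightarrow> (nat \<Rightarrow> real) \<Rightarrow> real \<Rightarrow> int" where
  "max_rank n \<kappa> b = Max {r \<in> {-1..int n}. ext_key n \<kappa> r \<le> ereal b}"

text \<open>The pair \<open>(lb, ub)\<close> held by the receiver at time \<open>t\<close>, when it searches for keys in
  \<open>[a, b]\<close>. The bounds are integers because \<open>ub\<close> can become \<open>-1\<close>.\<close>

primrec bounds :: "nat \<Rightarrow> (nat \<Rightarrow> real) \<Rightarrow> real \<Rightarrow> real \<Rightarrow> nat \<Rightarrow> nat \<Rightarrow> int \<times> int" where
  "bounds k \<kappa> a b s 0 = (0, 2 ^ k - 1)"
| "bounds k \<kappa> a b s (Suc t) =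
    (let (l, u) = bounds k \<kappa> a b s t; x = slot_index k s t in
      if l \<le> int x \<and> int x \<le> u \<and> \<kappa> x < a then (int x + 1, u)
      else if l \<le> int x \<and> int x \<le> u \<and> b < \<kappa> x then (l, int x - 1)
      else (l, u))"

definition lb :: "nat \<Rightarrow> (nat \<Rightarrow> real) \<Rightarrow> real \<Rightarrow> real \<Rightarrow> nat \<Rightarrow> nat \<Rightarrow> int" where
  "lb k \<kappa> a b s t = fst (bounds k \<kappa> a b s t)"

definition ub :: "nat \<Rightarrow> (nat \<Rightarrow> real) \<Rightarrow> real \<Rightarrow> real \<Rightarrow> nat \<Rightarrow> nat \<Rightarrow> int" where
  "ub k \<kappa> a b s t = snd (bounds k \<kappa> a b s t)"

definition used :: "nat \<Rightarrow> (nat \<Rightarrow> real) \<Rightarrow> real \<Rightarrow> real \<Rightarrow> nat \<Rightarrow> nat \<Rightarrow> nat" where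
  "used k \<kappa> a b s t =
    (if lb k \<kappa> a b s t \<le> int (slot_index k s t) \<and> int (slot_index k s t) \<le> ub k \<kappa> a b s t
     then 1 else 0)"

definition hit :: "nat \<Rightarrow> (nat \<Rightarrow> real) \<Rightarrow> real \<Rightarrow> real \<Rightarrow> nat \<Rightarrow> nat \<Rightarrow> nat" where
  "hit k \<kappa> a b s t =
    (if min_rank (2 ^ k) \<kappa> a \<le> int (slot_index k s t)
        \<and> int (slot_index k s t) \<le> max_rank (2 ^ k) \<kappa> b
     then 1 else 0)"

text \<open>The initial slot \<open>0\<close> is not counted.\<close>

definition energy :: "nat \<Rightarrow> (nat \<Rightarrow> real) \<Rightarrow> real \<Rightarrow> real \<Rightarrow> nat \<Rightarrow> nat \<Rightarrow> nat" where
  "energy k \<kappa> a b s t = (\<Sum>j = 1..t. used k \<kappa> a b s j)"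

definition stops :: "nat \<Rightarrow> (nat \<Rightarrow> real) \<Rightarrow> real \<Rightarrow> real \<Rightarrow> nat \<Rightarrow> nat \<Rightarrow> bool" where
  "stops k \<kappa> a b s t \<longleftrightarrow>
    hit k \<kappa> a b s t = 1 \<or> lb k \<kappa> a b s (t + 1) > ub k \<kappa> a b s (t + 1)"

definition stop_time :: "nat \<Rightarrow> (nat \<Rightarrow> real) \<Rightarrow> real \<Rightarrow> real \<Rightarrow> nat \<Rightarrow> nat" where
  "stop_time k \<kappa> a b s = (LEAST t. stops k \<kappa> a b s t)"

end

(* A slot that is received but is not a hit removes its index from the receiver's interval for
   good. The slots of a dyadic block [m 2^i, (m+1) 2^i) transmit a full residue class of indices
   modulo 2^(k-i). Hence, once such a block has been passed without a hit, the interval meets every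
   residue class modulo 2^(k-i) at most once, so the next block of length 2^i costs at most one unit.
   Let E_i be the end of the first aligned block of length 2^i that starts at s or later. The range
   [E_i, E_(i+1)) consists of one or two aligned blocks of length 2^i, each preceded by such a block
   that has been passed entirely; so it costs at most 2. Since E_0 = s + 1 and E_k >= s + 2^k, the
   total cost is at most 2 k. *)
theory Submission
  imports Defs
begin

section \<open>Bit reversal\<close>

lemma bit_bit_rev_iff: "bit (bit_rev k x) j \<longleftrightarrow> j < k \<and> bit x (k - 1 - j)"
proof -
  have "bit_rev k x = (\<Sum>i<k. of_bool (bit x (k - Suc i)) * 2 ^ i)"
    unfolding bit_rev_def
    by (subst sum.nat_diff_reindex [symmetric]) (auto intro!: sum.cong)
  also have "\<dots> = horner_sum of_bool 2 (map (\<lambda>i. bit x (k - Suc i)) [0..<k])"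
    by (simp add: horner_sum_eq_sum lessThan_atLeast0 cong: sum.cong_simp)
  finally show ?thesis
    by (auto simp: bit_horner_sum_bit_iff)
qed

text \<open>Reversal reads only the bits below position \<open>k\<close>, so the reduction modulo
  \<open>2 ^ k\<close> leaves no trace.\<close>

lemma bit_slot_index_iff: "bit (slot_index k s t) j \<longleftrightarrow> j < k \<and> bit (s + t) (k - 1 - j)"
  by (auto simp: slot_index_def bit_bit_rev_iff bit_take_bit_iff simp flip: take_bit_eq_mod)

lemma slot_index_less: "slot_index k s t < 2 ^ k"
proof -
  have "take_bit k (slot_index k s t) = slot_index k s t"
    by (rule bit_eqI) (auto simp: bit_take_bit_iff bit_slot_index_iff)
  then show ?thesis
    by (simp add: take_bit_nat_eq_self_iff)
qed

text \<open>Slots of one aligned block of length \<open>2 ^ i\<close> share all bits from position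
  \<open>i\<close> on, and reversal moves those below \<open>k\<close> to the positions below
  \<open>k - i\<close>.\<close>

lemma slot_index_cong_block:
  assumes "(s + t) div 2 ^ i = (s + t') div 2 ^ i"
  shows "slot_index k s t mod 2 ^ (k - i) = slot_index k s t' mod 2 ^ (k - i)"
proof -
  have *: "bit (s + t) (i + l) \<longleftrightarrow> bit (s + t') (i + l)" for l
    using assms by (metis bit_drop_bit_eq comp_apply drop_bit_eq_div)
  have "take_bit (k - i) (slot_index k s t) = take_bit (k - i) (slot_index k s t')"
  proof (rule bit_eqI)
    fix j
    show "bit (take_bit (k - i) (slot_index k s t)) j
      \<longleftrightarrow> bit (take_bit (k - i) (slot_index k s t')) j"
      using * [of "k - 1 - j - i"] by (auto simp: bit_take_bit_iff bit_slot_index_iff)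
  qed
  then show ?thesis
    by (simp add: take_bit_eq_mod)
qed

text \<open>Conversely, the low \<open>i\<close> bits of a slot vary freely within its block and
  reverse to the index bits from \<open>k - i\<close> on.\<close>

lemma slot_index_surj_block:
  assumes "y < 2 ^ k" "y mod 2 ^ (k - i) = slot_index k s t mod 2 ^ (k - i)"
  obtains u where "u div 2 ^ i = (s + t) div 2 ^ i" "bit_rev k (u mod 2 ^ k) = y"
proof
  \<comment> \<open>The high bits fix the block; the low bits are chosen so that their reversal
    gives \<open>y\<close>.\<close>
  define u where
    "u = or (push_bit i (drop_bit i (s + t))) (take_bit i (bit_rev k y))"
  have bit_u: "bit u j \<longleftrightarrow> (if i \<le> j then bit (s + t) j else bit (bit_rev k y) j)" for j
    by (auto simp: u_def bit_or_iff bit_push_bit_iff bit_take_bit_iff bit_drop_bit_eq)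
  have "drop_bit i u = drop_bit i (s + t)"
    by (rule bit_eqI) (simp add: bit_drop_bit_eq bit_u)
  then show "u div 2 ^ i = (s + t) div 2 ^ i"
    by (simp add: drop_bit_eq_div)
  have "take_bit (k - i) y = take_bit (k - i) (slot_index k s t)"
    using assms(2) by (simp add: take_bit_eq_mod)
  then have *: "bit (take_bit (k - i) y) j \<longleftrightarrow> bit (take_bit (k - i) (slot_index k s t)) j" for j
    by simp
  have y1: "bit y j \<longleftrightarrow> bit (s + t) (k - 1 - j)" if "j < k - i" for j
    using that * [of j] by (auto simp: bit_take_bit_iff bit_slot_index_iff)
  have y2: "\<not> bit y j" if "k \<le> j" for j
    using assms(1) that by (metis bit_take_bit_iff linorder_not_le take_bit_nat_eq_self_iff)
  show "bit_rev k (u mod 2 ^ k) = y"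
  proof (rule bit_eqI)
    fix j
    show "bit (bit_rev k (u mod 2 ^ k)) j \<longleftrightarrow> bit y j"
    proof (cases "j < k")
      case True
      then have "bit (bit_rev k (u mod 2 ^ k)) j \<longleftrightarrow> bit u (k - 1 - j)"
        by (auto simp: bit_bit_rev_iff bit_take_bit_iff simp flip: take_bit_eq_mod)
      also have "\<dots> \<longleftrightarrow> bit y j"
      proof (cases "i \<le> k - 1 - j")
        case le: True
        then have "j < k - i"
          using True by linarith
        then show ?thesis
          using y1 le by (simp add: bit_u)
      next
        case False
        \<comment> \<open>Here \<open>u\<close> carries a bit of the reversed \<open>y\<close>, and
          reversing twice restores position \<open>j\<close>.\<close>
        moreover have "k - 1 - (k - 1 - j) = j"
          using True by linarith
        ultimately show ?thesis
          using True by (simp add: bit_u bit_bit_rev_iff)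
      qed
      finally show ?thesis .
    next
      case False
      then show ?thesis
        using y2 by (simp add: bit_bit_rev_iff)
    qed
  qed
qed

section \<open>The receiver's interval\<close>

lemma lb_mono: "t \<le> t' \<Longrightarrow> lb k \<kappa> a b s t \<le> lb k \<kappa> a b s t'"
  by (rule lift_Suc_mono_le [of "lb k \<kappa> a b s"])
    (auto simp: lb_def Let_def split: prod.splits)

lemma ub_antimono: "t \<le> t' \<Longrightarrow> ub k \<kappa> a b s t' \<le> ub k \<kappa> a b s t"
  by (rule lift_Suc_antimono_le [of "ub k \<kappa> a b s"])
    (auto simp: ub_def Let_def split: prod.splits)

text \<open>The index itself belongs to both sets whose minimum and maximum are the ranks.\<close>

lemma hit_if_key_between:
  assumes "a \<le> \<kappa> (slot_index k s t)" "\<kappa> (slot_index k s t) \<le> b"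
  shows "hit k \<kappa> a b s t = 1"
proof -
  let ?x = "int (slot_index k s t)"
  have x: "?x \<in> {-1..int (2 ^ k)}" "ext_key (2 ^ k) \<kappa> ?x = ereal (\<kappa> (slot_index k s t))"
    using slot_index_less [of k s t] by (auto simp: ext_key_def zless_nat_eq_int_zless)
  have "min_rank (2 ^ k) \<kappa> a \<le> ?x"
    unfolding min_rank_def using assms x by (intro Min_le finite_Collect_conjI) auto
  moreover have "?x \<le> max_rank (2 ^ k) \<kappa> b"
    unfolding max_rank_def using assms x by (intro Max_ge finite_Collect_conjI) auto
  ultimately show ?thesis
    by (simp add: hit_def)
qed

text \<open>A missed index is outside the interval already; a received one that is no hit has its
  key below \<open>a\<close> or above \<open>b\<close>, and the update cuts it off.\<close>

lemma slot_index_notin_Suc_interval: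
  assumes "hit k \<kappa> a b s j \<noteq> 1"
  shows "int (slot_index k s j) \<notin> {lb k \<kappa> a b s (Suc j)..ub k \<kappa> a b s (Suc j)}"
  using assms hit_if_key_between [of a \<kappa> k s j b]
  by (auto simp: lb_def ub_def Let_def split: prod.splits if_splits)

lemma slot_index_notin_interval:
  assumes "hit k \<kappa> a b s j \<noteq> 1" "j < t"
  shows "int (slot_index k s j) \<notin> {lb k \<kappa> a b s t..ub k \<kappa> a b s t}"
  using slot_index_notin_Suc_interval [OF assms(1)]
    lb_mono [of "Suc j" t k \<kappa> a b s] ub_antimono [of "Suc j" t k \<kappa> a b s] assms(2)
  by auto

text \<open>Otherwise the interval would still be nonempty after a full period, yet its left end,
  like every index, was transmitted and removed within that period.\<close>

lemma stops_before_period: "\<exists>t < 2 ^ k. stops k \<kappa> a b s t"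
proof (rule ccontr)
  let ?N = "2 ^ k :: nat"
  assume "\<not> ?thesis"
  then have nostop: "\<not> stops k \<kappa> a b s t" if "t < ?N" for t
    using that by blast
  define y where "y = nat (lb k \<kappa> a b s ?N)"
  \<comment> \<open>\<open>stops\<close> inspects the bounds one step later, hence the time
    \<open>?N - 1\<close>.\<close>
  have "lb k \<kappa> a b s ?N \<le> ub k \<kappa> a b s ?N"
    using nostop [of "?N - 1"] by (simp add: stops_def)
  moreover have "0 \<le> lb k \<kappa> a b s ?N" "ub k \<kappa> a b s ?N \<le> 2 ^ k - 1"
    using lb_mono [of 0 ?N k \<kappa> a b s] ub_antimono [of 0 ?N k \<kappa> a b s]
    by (simp_all add: lb_def ub_def)
  ultimately have y: "int y \<in> {lb k \<kappa> a b s ?N..ub k \<kappa> a b s ?N}" "int y < 2 ^ k"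
    by (auto simp: y_def)
  then have "y < 2 ^ k"
    by (simp add: zless_nat_eq_int_zless)
  \<comment> \<open>For blocks of length \<open>2 ^ k\<close> the modulus is 1 and the congruence is
    trivial.\<close>
  then obtain u where u: "bit_rev k (u mod 2 ^ k) = y"
    by (rule slot_index_surj_block [of y k k s 0]) simp
  define j where "j = nat ((int u - int s) mod int ?N)"
  have "j < ?N"
    by (simp add: j_def nat_less_iff)
  have "int ((s + j) mod ?N) = int (u mod ?N)"
    by (simp add: j_def zmod_int mod_add_right_eq)
  then have "slot_index k s j = y"
    unfolding slot_index_def using u by (metis of_nat_eq_iff)
  then show False
    using slot_index_notin_interval [of k \<kappa> a b s j ?N] nostop [of j] y \<open>j < ?N\<close>
    by (auto simp: stops_def)
qed

section \<open>Counting the received slots\<close>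

text \<open>Slots are counted in absolute time, so that dyadic blocks are aligned to multiples of
  their length.\<close>

definition used_slots ::
  "nat \<Rightarrow> (nat \<Rightarrow> real) \<Rightarrow> real \<Rightarrow> real \<Rightarrow> nat \<Rightarrow> nat \<Rightarrow> nat set" where
  "used_slots k \<kappa> a b s \<tau> = {u. s < u \<and> u \<le> s + \<tau> \<and> used k \<kappa> a b s (u - s) = 1}"

lemma energy_eq_card_used_slots: "energy k \<kappa> a b s \<tau> = card (used_slots k \<kappa> a b s \<tau>)"
proof -
  have "energy k \<kappa> a b s \<tau> = card {j \<in> {1..\<tau>}. used k \<kappa> a b s j = 1}"
    unfolding energy_def card_eq_sum
    by (subst sum.inter_filter) (auto simp: used_def intro!: sum.cong)
  also have "\<dots> = card (used_slots k \<kappa> a b s \<tau>)"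
    by (rule bij_betw_same_card [of "\<lambda>j. s + j"], rule bij_betw_byWitness [of _ "\<lambda>u. u - s"])
      (auto simp: used_slots_def)
  finally show ?thesis .
qed

lemma used_slotsD:
  assumes "u \<in> used_slots k \<kappa> a b s \<tau>"
  shows "s < u" "u - s \<le> \<tau>"
    "int (slot_index k s (u - s)) \<in> {lb k \<kappa> a b s (u - s)..ub k \<kappa> a b s (u - s)}"
  using assms by (auto simp: used_slots_def used_def split: if_splits)

lemma ex_mod_eq_between:
  fixes c d x :: nat
  assumes "0 < d"
  shows "\<exists>y. x \<le> y \<and> y < x + d \<and> y mod d = c mod d"
proof -
  \<comment> \<open>\<open>d - x mod d\<close> stands for \<open>-x\<close> modulo \<open>d\<close>,
    so \<open>?y\<close> is the first member of the class of \<open>c\<close> from \<open>x\<close>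
    on.\<close>
  let ?y = "x + (c + (d - x mod d)) mod d"
  have "x + (c + (d - x mod d)) = c + d * Suc (x div d)"
    using mod_less_divisor [OF assms, of x] mult_div_mod_eq [of d x]
    unfolding mult_Suc_right by linarith
  then have "?y mod d = c mod d"
    by (metis mod_add_right_eq mod_mult_self2)
  then show ?thesis
    using assms by (intro exI [of _ ?y]) simp
qed

text \<open>Two indices received in block \<open>Suc m\<close> would be distinct and congruent
  modulo \<open>2 ^ (k - i)\<close>. Then block \<open>m\<close> transmitted some index in their
  range, which is therefore gone, although the interval still contains both of them. The last
  assumption orders the indices, not the slots.\<close>

lemma used_slots_block_unique:
  assumes nohit: "\<forall>j<\<tau>. hit k \<kappa> a b s j \<noteq> 1"
    and "s \<le> m * 2 ^ i"
    and u: "u \<in> used_slots k \<kappa> a b s \<tau>" "u div 2 ^ i = Suc m"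
    and v: "v \<in> used_slots k \<kappa> a b s \<tau>" "v div 2 ^ i = Suc m"
    and "slot_index k s (u - s) \<le> slot_index k s (v - s)"
  shows "u = v"
proof (rule ccontr)
  assume "u \<noteq> v"
  let ?x = "\<lambda>w. slot_index k s (w - s)"
  let ?I = "\<lambda>t. {lb k \<kappa> a b s t..ub k \<kappa> a b s t}"
  let ?d = "2 ^ (k - i) :: nat"
  have su: "s < u" "u - s \<le> \<tau>" "int (?x u) \<in> ?I (u - s)"
    and sv: "s < v" "v - s \<le> \<tau>" "int (?x v) \<in> ?I (v - s)"
    using used_slotsD [OF u(1)] used_slotsD [OF v(1)] by blast+
  \<comment> \<open>At the earlier of the two times the interval contains both indices, since it
    only shrinks.\<close>
  define t where "t = min u v - s"
  have t: "t \<le> u - s" "t \<le> v - s"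
    by (simp_all add: t_def diff_le_mono)
  then have "?I (u - s) \<subseteq> ?I t" "?I (v - s) \<subseteq> ?I t"
    by (simp_all add: lb_mono ub_antimono)
  then have It: "int (?x u) \<in> ?I t" "int (?x v) \<in> ?I t"
    using su sv by auto
  have gone: "int (?x w) \<notin> ?I l" if "s \<le> w" "w < s + l" "l \<le> \<tau>" for w l
  proof (rule slot_index_notin_interval)
    show "hit k \<kappa> a b s (w - s) \<noteq> 1" "w - s < l"
      using nohit that by auto
  qed
  \<comment> \<open>The index of the earlier slot has been removed by the time the later slot is
    received.\<close>
  have "?x u \<noteq> ?x v"
  proof (cases "u < v")
    case True
    then show ?thesis
      using gone [of u "v - s"] su sv by auto
  next
    case False
    then show ?thesis
      using gone [of v "u - s"] su sv \<open>u \<noteq> v\<close> by auto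
  qed
  then have less: "?x u < ?x v"
    using assms by simp
  have "?x u mod ?d = ?x v mod ?d"
    by (rule slot_index_cong_block) (use u v su sv in simp)
  then have "?d dvd ?x v - ?x u"
    using less by (metis mod_eq_dvd_iff_nat nat_less_le)
  then have gap: "?x u + ?d \<le> ?x v"
    using less dvd_imp_le [of ?d "?x v - ?x u"] by linarith
  \<comment> \<open>\<open>m * 2 ^ i - s\<close> is the receiver time at which block
    \<open>m\<close> begins; its index represents the residue class of that block.\<close>
  obtain y where y: "?x u \<le> y" "y < ?x u + ?d"
    "y mod ?d = slot_index k s (m * 2 ^ i - s) mod ?d"
    using ex_mod_eq_between [of ?d] by (meson pos2 zero_less_power)
  then have xy: "?x u \<le> y" "y \<le> ?x v"
    using gap by linarith+
  have "y < 2 ^ k"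
    using xy slot_index_less [of k s "v - s"] by linarith
  then obtain w where w: "w div 2 ^ i = (s + (m * 2 ^ i - s)) div 2 ^ i" "bit_rev k (w mod 2 ^ k) = y"
    using y(3) slot_index_surj_block by blast
  have "w div 2 ^ i = m"
    using w(1) \<open>s \<le> m * 2 ^ i\<close> by simp
  then have "m * 2 ^ i \<le> w" "w < Suc m * 2 ^ i"
    using div_times_less_eq_dividend [of w "2 ^ i"] dividend_less_div_times [of "2 ^ i" w]
    by simp_all
  moreover have "Suc m * 2 ^ i \<le> u" "Suc m * 2 ^ i \<le> v"
    using u(2) v(2) by (metis div_times_less_eq_dividend)+
  ultimately have "s \<le> w" "w < u" "w < v"
    using \<open>s \<le> m * 2 ^ i\<close> by linarith+
  moreover from this have "?x w = y"
    using w(2) by (simp add: slot_index_def)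
  moreover have "int y \<in> ?I t"
    using It xy by auto
  ultimately show False
    using gone [of w t] su sv t by (auto simp: t_def)
qed

lemma card_used_slots_block_le:
  assumes "\<forall>j<\<tau>. hit k \<kappa> a b s j \<noteq> 1" "s \<le> m * 2 ^ i"
  shows "card (used_slots k \<kappa> a b s \<tau> \<inter> {Suc m * 2 ^ i..<Suc (Suc m) * 2 ^ i}) \<le> 1"
    (is "card ?A \<le> 1")
proof -
  have div: "u div 2 ^ i = Suc m" if "u \<in> ?A" for u
    using that by (intro div_nat_eqI) (auto simp: algebra_simps)
  \<comment> \<open>Uniqueness presupposes an order of the two indices, so it is applied both
    ways.\<close>
  have "u = v" if "u \<in> ?A" "v \<in> ?A" for u v
    using used_slots_block_unique [OF assms, of u v] used_slots_block_unique [OF assms, of v u]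
      that div [OF that(1)] div [OF that(2)]
    by (metis IntD1 nle_le)
  moreover have "finite ?A"
    by simp
  ultimately show ?thesis
    by (auto simp: card_le_Suc0_iff_eq)
qed

lemma ex_block_card_used_slots_le:
  assumes nohit: "\<forall>j<\<tau>. hit k \<kappa> a b s j \<noteq> 1"
  shows "\<exists>m. s \<le> m * 2 ^ i
    \<and> card (used_slots k \<kappa> a b s \<tau> \<inter> {..<Suc m * 2 ^ i}) \<le> 2 * i"
proof (induction i)
  case 0
  \<comment> \<open>Slot \<open>s\<close> itself is not counted.\<close>
  have "used_slots k \<kappa> a b s \<tau> \<inter> {..<Suc s} = {}"
    by (auto simp: used_slots_def)
  then show ?case
    by (intro exI [of _ s]) simp
next
  case (Suc i)
  let ?U = "used_slots k \<kappa> a b s \<tau>"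
  from Suc obtain m where m: "s \<le> m * 2 ^ i" "card (?U \<inter> {..<Suc m * 2 ^ i}) \<le> 2 * i"
    by blast
  have step: "card (?U \<inter> {..<Suc (Suc l) * 2 ^ i}) \<le> Suc (card (?U \<inter> {..<Suc l * 2 ^ i}))"
    if "s \<le> l * 2 ^ i" for l
  proof -
    have "{..<Suc (Suc l) * 2 ^ i} = {..<Suc l * 2 ^ i} \<union> {Suc l * 2 ^ i..<Suc (Suc l) * 2 ^ i}"
      by (subst ivl_disj_un_one(2)) auto
    then have "card (?U \<inter> {..<Suc (Suc l) * 2 ^ i}) \<le> card (?U \<inter> {..<Suc l * 2 ^ i})
      + card (?U \<inter> {Suc l * 2 ^ i..<Suc (Suc l) * 2 ^ i})"
      by (metis Int_Un_distrib card_Un_le)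
    with card_used_slots_block_le [OF nohit that] show ?thesis
      by simp
  qed
  have m1: "s \<le> Suc m * 2 ^ i"
    using m(1) by simp
  show ?case
  proof (cases "even m")
    case True
    \<comment> \<open>Block \<open>m\<close> is the left half of block \<open>l\<close> of double
      length; only the right half has to be added.\<close>
    then obtain l where "m = 2 * l" ..
    then show ?thesis
      using m step [OF m(1)] by (intro exI [of _ l]) (simp add: algebra_simps)
  next
    case False
    \<comment> \<open>Block \<open>m\<close> is a right half, and the double block around it may
      start before \<open>s\<close>. The next double block is taken instead; its halves
      \<open>Suc m\<close> and \<open>Suc (Suc m)\<close> cost one unit each.\<close>
    then obtain l where "m = 2 * l + 1" ..
    then show ?thesis
      using m m1 step [OF m(1)] step [OF m1] by (intro exI [of _ "Suc l"]) (simp add: algebra_simps)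
  qed
qed

theorem theorem1:
  fixes k n s :: nat and \<kappa> :: "nat \<Rightarrow> real" and a b :: real
  assumes "n = 2 ^ k"
    and "mono_on {0..<n} \<kappa>"
    and "a \<le> b"
    and "s < n"
  shows "(\<exists>t. stops k \<kappa> a b s t)
    \<and> stop_time k \<kappa> a b s < n
    \<and> energy k \<kappa> a b s (stop_time k \<kappa> a b s) \<le> 2 * k + 1"
proof -
  define \<tau> where "\<tau> = stop_time k \<kappa> a b s"
  obtain t where t: "t < n" "stops k \<kappa> a b s t"
    using stops_before_period assms(1) by blast
  then have "\<tau> < n"
    unfolding \<tau>_def stop_time_def by (meson Least_le le_less_trans)
  have "\<forall>j<\<tau>. hit k \<kappa> a b s j \<noteq> 1"
    using not_less_Least unfolding \<tau>_def stop_time_def stops_def by blast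
  then obtain m where m: "s \<le> m * 2 ^ k"
    "card (used_slots k \<kappa> a b s \<tau> \<inter> {..<Suc m * 2 ^ k}) \<le> 2 * k"
    using ex_block_card_used_slots_le by blast
  \<comment> \<open>Counted slots lie below \<open>s + 2 ^ k\<close>, which is at most
    \<open>Suc m * 2 ^ k\<close>.\<close>
  have "used_slots k \<kappa> a b s \<tau> \<subseteq> {..<Suc m * 2 ^ k}"
    using m(1) \<open>\<tau> < n\<close> assms(1) by (auto simp: used_slots_def)
  then have "energy k \<kappa> a b s \<tau> \<le> 2 * k"
    using m(2) by (simp add: energy_eq_card_used_slots Int_absorb2)
  then show ?thesis
    using t \<open>\<tau> < n\<close> by (auto simp: \<tau>_def)
qed

end
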